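(* Let $X$ and $Y$ be Tychonoff spaces and let $\varphi: X \to Y$ be a continuous finite-to-one surjective mapping (that is, $\varphi^{-1}(y)$ is finite for every $y \in Y$). If $Y$ is a $\Delta$-space, then $X$ is also a $\Delta$-space.
   Context: A topological space $X$ is a $\Delta$-space if for every decreasing sequence $\{D_n: n \in \omega\}$ of subsets of $X$ with empty intersection there is a decreasing sequence $\{V_n: n \in \omega\}$ of open subsets of $X$, also with empty intersection, such that $D_n \subset V_n$ for every $n \in \omega$. *)

theory Defs
  imports "HOL-Analysis.Analysis"
begin

definition Tychonoff_space :: "'a topology \<Rightarrow> bool" where
  "Tychonoff_space X \<longleftrightarrow> completely_regular_space X \<and> t1_space X"

definition Delta_space :: "'a topology \<Rightarrow> bool" where
  "Delta_space X \<longleftrightarrow>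
     (\<forall>D :: nat \<Rightarrow> 'a set.
        (\<forall>n. D n \<subseteq> topspace X) \<and> decseq D \<and> (\<Inter>n. D n) = {} \<longrightarrow>
        (\<exists>V :: nat \<Rightarrow> 'a set.
           (\<forall>n. openin X (V n)) \<and> decseq V \<and> (\<Inter>n. V n) = {} \<and> (\<forall>n. D n \<subseteq> V n)))"

definition finite_to_one_map :: "'a topology \<Rightarrow> 'b topology \<Rightarrow> ('a \<Rightarrow> 'b) \<Rightarrow> bool" where
  "finite_to_one_map X Y f \<longleftrightarrow> (\<forall>y \<in> topspace Y. finite {x \<in> topspace X. f x = y})"

end

theory Submission
  imports Defs
begin

text \<open>
  A decreasing sequence \<open>D\<close> in \<open>X\<close> is pushed forward to \<open>Y\<close>, enlarged there to open sets, and
  the enlargement is pulled back along the continuous map. Pulling back preserves everything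
  that is wanted: openness, monotonicity and vanishing intersection. The only doubtful step is
  that the images of \<open>D\<close> still have empty intersection, and this is where finiteness of the
  fibres enters: each point of a fibre leaves \<open>D\<close> at some stage, so a finite fibre misses \<open>D\<close>
  altogether from the latest of these stages on, and its base point drops out of the images.
\<close>

text \<open>
  With infinite fibres this fails: the tails of \<open>\<nat>\<close> have empty intersection, yet a constant map
  sends all of them to the same point.
\<close>
lemma Inter_image_decseq_empty:
  fixes D :: "nat \<Rightarrow> 'a set"
  assumes fin: "\<And>y. finite {x \<in> D 0. f x = y}"
    and dec: "decseq D"
    and empty: "(\<Inter>n. D n) = {}"
  shows "(\<Inter>n. f ` D n) = {}"
proof (rule ccontr)
  assume "(\<Inter>n. f ` D n) \<noteq> {}"
  then obtain y where y: "\<And>n. y \<in> f ` D n"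
    by blast
  define F where "F = {x \<in> D 0. f x = y}"
  have "\<exists>n. x \<notin> D n" for x
    using empty by blast
  then obtain stage where stage: "\<And>x. x \<notin> D (stage x)"
    by metis
  define N where "N = Max (stage ` F)"
  obtain x where x: "x \<in> D N" "f x = y"
    using y[of N] by blast
  have "x \<in> F"
    using x decseqD[OF dec, of 0 N] by (auto simp: F_def)
  then have "stage x \<le> N"
    using fin[of y] by (simp add: N_def F_def)
  then show False
    using x(1) stage[of x] decseqD[OF dec] by blast
qed

theorem proposition2p12:
  fixes X :: "'a topology" and Y :: "'b topology" and \<phi> :: "'a \<Rightarrow> 'b"
  assumes "Tychonoff_space X" and "Tychonoff_space Y"
    and "continuous_map X Y \<phi>"
    and "finite_to_one_map X Y \<phi>"
    and "\<phi> ` topspace X = topspace Y"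
    and "Delta_space Y"
  shows "Delta_space X"
  unfolding Delta_space_def
proof (intro allI impI, elim conjE)
  fix D :: "nat \<Rightarrow> 'a set"
  assume sub: "\<forall>n. D n \<subseteq> topspace X" and dec: "decseq D" and empty: "(\<Inter>n. D n) = {}"
  have fin: "finite {x \<in> D 0. \<phi> x = y}" for y
  proof (cases "y \<in> topspace Y")
    case True
    then have "finite {x \<in> topspace X. \<phi> x = y}"
      using assms(4) by (simp add: finite_to_one_map_def)
    then show ?thesis
      by (rule rev_finite_subset) (use sub in auto)
  next
    case False
    then have "{x \<in> D 0. \<phi> x = y} = {}"
      using sub assms(5) by blast
    then show ?thesis
      by (metis finite.emptyI)
  qed
  have "\<forall>n. \<phi> ` D n \<subseteq> topspace Y"
    using sub assms(5) by blast
  moreover have "decseq (\<lambda>n. \<phi> ` D n)"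
    using dec by (simp add: decseq_def image_mono)
  moreover have "(\<Inter>n. \<phi> ` D n) = {}"
    using fin dec empty by (rule Inter_image_decseq_empty)
  ultimately obtain V where V: "\<And>n. openin Y (V n)" "decseq V" "(\<Inter>n. V n) = {}"
      "\<And>n. \<phi> ` D n \<subseteq> V n"
    using assms(6) unfolding Delta_space_def by (metis (no_types, lifting))
  define W where "W n = {x \<in> topspace X. \<phi> x \<in> V n}" for n
  have "openin X (W n)" for n
    unfolding W_def using assms(3) V(1) by (rule openin_continuous_map_preimage)
  moreover have "decseq W"
    using V(2) by (auto simp: W_def decseq_def)
  moreover have "(\<Inter>n. W n) = {}"
    using V(3) by (auto simp: W_def)
  moreover have "D n \<subseteq> W n" for n
    using sub V(4)[of n] by (auto simp: W_def)
  ultimately show "\<exists>V. (\<forall>n. openin X (V n)) \<and> decseq V \<and> (\<Inter>n. V n) = {} \<and> (\<forall>n. D n \<subseteq> V n)"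
    by blast
qed

end
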